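(* Let $n\ge 2$ and set $k=\lfloor n/2\rfloor$. Let $P_n$ be the path on vertices $v_1,\dots,v_n$ with edges $v_iv_{i+1}$ ($1\le i\le n-1$). Let $E_n$ (resp. $O_n$) be the graph obtained from $P_n$ by attaching one pendant vertex $\ell_i$ (adjacent only to $v_i$) to each vertex $v_i$ with $i$ even (resp. $i$ odd). Then $$\gamma(E_n)=k,\qquad \zeta(E_n)=\begin{cases}F_{k+1},& n=2k,\\ F_k,& n=2k+1,\end{cases}$$ and $$\gamma(O_n)=\lceil n/2\rceil,\qquad \zeta(O_n)=\begin{cases}F_{k+1},& n=2k,\\ F_{k+3},& n=2k+1,\end{cases}$$ where $(F_t)_{t\ge 1}$ is the Fibonacci sequence defined by $F_1=F_2=1$ and $F_{t+1}=F_t+F_{t-1}$.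
   Context: For a finite simple graph $G$, a set $D\subseteq V(G)$ is dominating if every vertex of $G$ lies in $D$ or has a neighbor in $D$. The domination number $\gamma(G)$ is the minimum size of a dominating set. The dominion $\zeta(G)$ is the number of dominating sets of $G$ of size $\gamma(G)$. *)

theory Defs
  imports Complex_Main "HOL-Number_Theory.Fib"
begin

text \<open>A graph is a pair of a vertex set and a set of edges, an edge being the set of its two ends.\<close>

type_synonym 'a graph = "'a set \<times> 'a set set"

abbreviation verts :: "'a graph \<Rightarrow> 'a set" where
  "verts G \<equiv> fst G"

abbreviation edges :: "'a graph \<Rightarrow> 'a set set" where
  "edges G \<equiv> snd G"

definition finite_simple_graph :: "'a graph \<Rightarrow> bool" where
  "finite_simple_graph G \<longleftrightarrow>
     finite (verts G) \<and> (\<forall>e\<in>edges G. e \<subseteq> verts G \<and> card e = 2)"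

definition dominating :: "'a graph \<Rightarrow> 'a set \<Rightarrow> bool" where
  "dominating G D \<longleftrightarrow>
     D \<subseteq> verts G \<and> (\<forall>v\<in>verts G. v \<in> D \<or> (\<exists>u\<in>D. {u, v} \<in> edges G))"

definition domination_number :: "'a graph \<Rightarrow> nat" where
  "domination_number G = Min (card ` {D. dominating G D})"

definition dominion :: "'a graph \<Rightarrow> nat" where
  "dominion G = card {D. dominating G D \<and> card D = domination_number G}"

text \<open>\<open>Path i\<close> is the path vertex $v_i$; \<open>Leaf i\<close> is the pendant vertex $\ell_i$ attached to it.\<close>

datatype vertex = Path nat | Leaf nat

definition path_graph :: "nat \<Rightarrow> vertex graph" where
  "path_graph n = (Path ` {1..n}, {{Path i, Path (i + 1)} | i. 1 \<le> i \<and> i + 1 \<le> n})"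

definition attach_leaves :: "nat set \<Rightarrow> vertex graph \<Rightarrow> vertex graph" where
  "attach_leaves S G =
     (verts G \<union> Leaf ` S, edges G \<union> {{Path i, Leaf i} | i. i \<in> S})"

definition E_graph :: "nat \<Rightarrow> vertex graph" where
  "E_graph n = attach_leaves {i \<in> {1..n}. even i} (path_graph n)"

definition O_graph :: "nat \<Rightarrow> vertex graph" where
  "O_graph n = attach_leaves {i \<in> {1..n}. odd i} (path_graph n)"

lemma finite_simple_graph_attach_leaves:
  "S \<subseteq> {1..n} \<Longrightarrow> finite_simple_graph (attach_leaves S (path_graph n))"
  by (auto simp: finite_simple_graph_def attach_leaves_def path_graph_def
      intro: finite_subset)

lemma finite_simple_graph_E_graph: "finite_simple_graph (E_graph n)"
  and finite_simple_graph_O_graph: "finite_simple_graph (O_graph n)"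
  unfolding E_graph_def O_graph_def by (auto intro: finite_simple_graph_attach_leaves)

text \<open>For a finite graph, the minimum defining the domination number ranges over
  a finite nonempty set, so it is attained.\<close>

lemma domination_number_attained:
  assumes "finite_simple_graph G"
  shows "finite (card ` {D. dominating G D})"
    and "card ` {D. dominating G D} \<noteq> {}"
proof -
  have "{D. dominating G D} \<subseteq> Pow (verts G)"
    by (auto simp: dominating_def)
  then show "finite (card ` {D. dominating G D})"
    using assms by (auto simp: finite_simple_graph_def intro: finite_subset)
  have "dominating G (verts G)"
    by (auto simp: dominating_def)
  then show "card ` {D. dominating G D} \<noteq> {}"
    by blast
qed

end

theory Submission
  imports Defs
begin

text \<open>A dominating set meets \<open>{v\<^sub>i, \<ell>\<^sub>i}\<close> for every supported \<open>i\<close>, so it has at least as many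
  elements as there are supports, and one attaining this bound consists of exactly one of
  \<open>v\<^sub>i, \<ell>\<^sub>i\<close> for each support. It is thus determined by the set \<open>A\<close> of supports whose path vertex is
  chosen, and it dominates iff every unsupported path vertex has a neighbour indexed by \<open>A\<close>. When
  supports and non-supports alternate, these \<open>A\<close> are binary words without two consecutive zeros,
  subject to boundary conditions, which gives the Fibonacci numbers.\<close>

section \<open>Dominating sets for an arbitrary set of supports\<close>

fun vertex_index :: "vertex \<Rightarrow> nat" where
  "vertex_index (Path i) = i"
| "vertex_index (Leaf i) = i"

definition transversal :: "nat set \<Rightarrow> nat set \<Rightarrow> vertex set" where
  "transversal S A = Path ` A \<union> Leaf ` (S - A)"

text \<open>The ends of the path get no special case: when \<open>S \<subseteq> {1..n}\<close>, the
  indices 0 and \<open>n + 1\<close> lie outside \<open>S\<close>, hence outside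
  \<open>A\<close>.\<close>

definition good_choices :: "nat set \<Rightarrow> nat \<Rightarrow> nat set set" where
  "good_choices S n = {A. A \<subseteq> S \<and> (\<forall>i\<in>{1..n} - S. i - 1 \<in> A \<or> i + 1 \<in> A)}"

text \<open>The range conditions on edges disappear because \<open>D\<close> contains only vertices:
  \<open>Path 0\<close>, \<open>Path (n + 1)\<close> and leaves off \<open>S\<close> are never in
  \<open>D\<close>, so index arithmetic alone describes adjacency.\<close>

lemma dominating_attach_leaves_iff:
  assumes "S \<subseteq> {1..n}"
  shows "dominating (attach_leaves S (path_graph n)) D \<longleftrightarrow>
    D \<subseteq> Path ` {1..n} \<union> Leaf ` S \<and>
    (\<forall>i\<in>{1..n}. Path i \<in> D \<or> Path (i - 1) \<in> D \<or> Path (i + 1) \<in> D \<or> Leaf i \<in> D) \<and>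
    (\<forall>i\<in>S. Path i \<in> D \<or> Leaf i \<in> D)"
    (is "?L \<longleftrightarrow> ?sub \<and> ?path \<and> ?leaf")
proof -
  define E where "E = edges (attach_leaves S (path_graph n))"
  have E1: "{u, Path i} \<in> E \<longleftrightarrow> (u = Path (i + 1) \<and> 1 \<le> i \<and> i + 1 \<le> n)
      \<or> (u = Path (i - 1) \<and> 2 \<le> i \<and> i \<le> n) \<or> (u = Leaf i \<and> i \<in> S)" for u i
    unfolding E_def attach_leaves_def path_graph_def
    by (cases i) (auto simp: doubleton_eq_iff)
  have E2: "{u, Leaf i} \<in> E \<longleftrightarrow> u = Path i \<and> i \<in> S" for u i
    unfolding E_def attach_leaves_def path_graph_def
    by (auto simp: doubleton_eq_iff)
  have V: "verts (attach_leaves S (path_graph n)) = Path ` {1..n} \<union> Leaf ` S"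
    by (simp add: attach_leaves_def path_graph_def)
  have path_iff: "(Path i \<in> D \<or> (\<exists>u\<in>D. {u, Path i} \<in> E)) \<longleftrightarrow>
      (Path i \<in> D \<or> Path (i - 1) \<in> D \<or> Path (i + 1) \<in> D \<or> Leaf i \<in> D)"
    if sub: ?sub and i: "i \<in> {1..n}" for i
  proof -
    have "Path j \<in> D \<Longrightarrow> 1 \<le> j \<and> j \<le> n" "Leaf j \<in> D \<Longrightarrow> j \<in> S" for j
      using sub by auto
    from this(1)[of "i - 1"] this(1)[of "i + 1"] this(2)[of i]
    have "Path (i - 1) \<in> D \<Longrightarrow> 2 \<le> i" "Path (i + 1) \<in> D \<Longrightarrow> i + 1 \<le> n" "Leaf i \<in> D \<Longrightarrow> i \<in> S"
      by auto
    moreover have "1 \<le> i" "i \<le> n"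
      using i by auto
    moreover have "(\<exists>u\<in>D. {u, Path i} \<in> E) \<longleftrightarrow> (Path (i + 1) \<in> D \<and> 1 \<le> i \<and> i + 1 \<le> n)
        \<or> (Path (i - 1) \<in> D \<and> 2 \<le> i \<and> i \<le> n) \<or> (Leaf i \<in> D \<and> i \<in> S)"
      unfolding E1 by blast
    ultimately show ?thesis by blast
  qed
  have leaf_iff: "(Leaf i \<in> D \<or> (\<exists>u\<in>D. {u, Leaf i} \<in> E)) \<longleftrightarrow> (Path i \<in> D \<or> Leaf i \<in> D)"
    if "i \<in> S" for i
    using that unfolding E2 by auto
  show ?thesis
  proof (cases ?sub)
    case True
    have "(\<forall>v\<in>Path ` {1..n} \<union> Leaf ` S. v \<in> D \<or> (\<exists>u\<in>D. {u, v} \<in> E)) \<longleftrightarrow> ?path \<and> ?leaf"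
      by (simp only: ball_Un ball_simps path_iff[OF True] leaf_iff cong: ball_cong)
    with True show ?thesis
      unfolding dominating_def E_def[symmetric] V by simp
  next
    case False
    then show ?thesis
      unfolding dominating_def V by simp
  qed
qed

text \<open>The pairs \<open>{Path i, Leaf i}\<close> are the fibres of \<open>vertex_index\<close>;
  meeting each fibre over \<open>S\<close> makes the image of \<open>D\<close> cover
  \<open>S\<close>, and an image is no larger than its source.\<close>

lemma card_support_le_card_dominating:
  assumes S: "S \<subseteq> {1..n}" and D: "dominating (attach_leaves S (path_graph n)) D"
  shows "finite D" and "S \<subseteq> vertex_index ` D" and "card S \<le> card D"
proof -
  show fin: "finite D"
    using D finite_simple_graph_attach_leaves[OF S] finite_subset
    unfolding dominating_def finite_simple_graph_def by blast
  show sub: "S \<subseteq> vertex_index ` D"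
  proof
    fix i assume "i \<in> S"
    then have "Path i \<in> D \<or> Leaf i \<in> D"
      using D dominating_attach_leaves_iff[OF S] by blast
    then show "i \<in> vertex_index ` D"
      by (force simp: image_iff)
  qed
  show "card S \<le> card D"
    using card_mono[OF finite_imageI[OF fin] sub] card_image_le[OF fin] le_trans by blast
qed

section \<open>Minimum dominating sets as transversals\<close>

lemma mem_transversal [simp]:
  "Path i \<in> transversal S A \<longleftrightarrow> i \<in> A"
  "Leaf i \<in> transversal S A \<longleftrightarrow> i \<in> S - A"
  by (auto simp: transversal_def)

lemma card_transversal:
  assumes "finite S" "A \<subseteq> S"
  shows "card (transversal S A) = card S"
proof -
  have "inj_on vertex_index (transversal S A)"
    by (auto simp: inj_on_def transversal_def)
  moreover have "vertex_index ` transversal S A = S"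
    using assms(2) by (force simp: transversal_def image_Un image_image)
  ultimately show ?thesis
    by (metis card_image)
qed

lemma dominating_transversal_iff:
  assumes S: "S \<subseteq> {1..n}" and A: "A \<subseteq> S"
  shows "dominating (attach_leaves S (path_graph n)) (transversal S A) \<longleftrightarrow> A \<in> good_choices S n"
proof -
  have "transversal S A \<subseteq> Path ` {1..n} \<union> Leaf ` S"
    using assms by (auto simp: transversal_def)
  moreover have "i \<in> A \<or> i - 1 \<in> A \<or> i + 1 \<in> A \<or> i \<in> S - A
      \<longleftrightarrow> i \<in> S \<or> i - 1 \<in> A \<or> i + 1 \<in> A" for i
    using A by blast
  ultimately show ?thesis
    using A unfolding dominating_attach_leaves_iff[OF S] good_choices_def mem_transversal
    by (simp add: Ball_def) blast
qed

text \<open>Equality in the lower bound makes \<open>vertex_index\<close> a bijection from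
  \<open>D\<close> onto \<open>S\<close>: surjectivity gives at least one vertex per pair and
  nothing off the supports, injectivity at most one.\<close>

lemma dominating_card_eq_imp_transversal:
  assumes S: "S \<subseteq> {1..n}" and D: "dominating (attach_leaves S (path_graph n)) D"
    and card: "card D = card S"
  shows "\<exists>A. A \<subseteq> S \<and> D = transversal S A"
proof -
  note D_props = card_support_le_card_dominating[OF S D]
  have "card (vertex_index ` D) \<le> card S"
    using card_image_le[OF D_props(1), of vertex_index] card by simp
  then have img: "vertex_index ` D = S"
    using card_seteq[OF finite_imageI[OF D_props(1)] D_props(2)] by simp
  have inj: "inj_on vertex_index D"
    by (rule eq_card_imp_inj_on[OF D_props(1)]) (simp add: img card)
  define A where "A = {i. Path i \<in> D}"
  have path: "i \<in> S" if "Path i \<in> D" for i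
    using imageI[OF that, of vertex_index] img by simp
  have leaf: "i \<in> S" if "Leaf i \<in> D" for i
    using imageI[OF that, of vertex_index] img by simp
  have one: "Leaf i \<notin> D" if "Path i \<in> D" for i
    using inj_onD[OF inj, of "Path i" "Leaf i"] that by auto
  have some: "Path i \<in> D \<or> Leaf i \<in> D" if "i \<in> S" for i
  proof -
    obtain v where "v \<in> D" "vertex_index v = i"
      using D_props(2) \<open>i \<in> S\<close> by blast
    then show ?thesis by (cases v) auto
  qed
  have "x \<in> D \<longleftrightarrow> x \<in> transversal S A" for x
  proof (cases x)
    case (Path i)
    then show ?thesis by (simp add: A_def)
  next
    case (Leaf i)
    then show ?thesis using leaf[of i] one[of i] some[of i] by (auto simp: A_def)
  qed
  then have "D = transversal S A"
    by (rule set_eqI)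
  moreover have "A \<subseteq> S"
    using path unfolding A_def by blast
  ultimately show ?thesis by blast
qed

text \<open>The assumption \<open>S \<in> good_choices S n\<close> says that taking the path vertex
  of every support dominates, so the bound \<open>card S\<close> is attained. Minimum dominating
  sets then correspond bijectively to good choices.\<close>

lemma domination_attach_leaves:
  assumes S: "S \<subseteq> {1..n}" and good: "S \<in> good_choices S n"
  shows "domination_number (attach_leaves S (path_graph n)) = card S"
    and "dominion (attach_leaves S (path_graph n)) = card (good_choices S n)"
proof -
  let ?G = "attach_leaves S (path_graph n)"
  have fin: "finite S"
    using S finite_subset by blast
  have "dominating ?G (transversal S S)"
    using dominating_transversal_iff[OF S order_refl] good by simp
  then have attained: "card S \<in> card ` {D. dominating ?G D}"
    by (intro image_eqI[of _ _ "transversal S S"]) (simp_all add: card_transversal[OF fin order_refl])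
  have "card S \<le> c" if "c \<in> card ` {D. dominating ?G D}" for c
    using card_support_le_card_dominating(3)[OF S] that by fast
  then show num: "domination_number ?G = card S"
    unfolding domination_number_def
    by (rule Min_eqI[OF domination_number_attained(1)[OF finite_simple_graph_attach_leaves[OF S]]
        _ attained])
  have "{D. dominating ?G D \<and> card D = card S} = transversal S ` good_choices S n"
  proof (intro set_eqI iffI)
    fix D assume "D \<in> {D. dominating ?G D \<and> card D = card S}"
    then have D: "dominating ?G D" "card D = card S"
      by simp_all
    obtain A where A: "A \<subseteq> S" "D = transversal S A"
      using dominating_card_eq_imp_transversal[OF S D] by blast
    then show "D \<in> transversal S ` good_choices S n"
      using D(1) dominating_transversal_iff[OF S A(1)] by simp
  next
    fix D assume "D \<in> transversal S ` good_choices S n"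
    then obtain A where A: "D = transversal S A" "A \<in> good_choices S n"
      by blast
    then have "A \<subseteq> S"
      by (simp add: good_choices_def)
    then show "D \<in> {D. dominating ?G D \<and> card D = card S}"
      using A dominating_transversal_iff[OF S] card_transversal[OF fin] by simp
  qed
  moreover have "inj (transversal S)"
  proof (rule injI, rule set_eqI)
    fix A B i assume "transversal S A = transversal S B"
    then show "i \<in> A \<longleftrightarrow> i \<in> B"
      by (metis mem_transversal(1))
  qed
  ultimately show "dominion ?G = card (good_choices S n)"
    unfolding dominion_def num by (simp add: card_image inj_on_subset)
qed

section \<open>Counting good choices for alternating supports, both parities at once\<close>

locale alternating =
  fixes P :: "nat \<Rightarrow> bool"
  assumes alternate: "P (Suc i) \<longleftrightarrow> \<not> P i"
begin

definition support :: "nat \<Rightarrow> nat set" where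
  "support n = {i \<in> {1..n}. P i}"

definition count :: "nat \<Rightarrow> nat" where
  "count n = card (good_choices (support n) n)"

text \<open>Split off from the inclusion in the support, so that one \<open>A\<close> can be tested
  against different \<open>n\<close>; the test at \<open>i = n\<close> may look one index beyond, at
  \<open>n + 1\<close>.\<close>

definition covers :: "nat set \<Rightarrow> nat \<Rightarrow> bool" where
  "covers A n \<longleftrightarrow> (\<forall>i\<in>{1..n}. \<not> P i \<longrightarrow> i - 1 \<in> A \<or> i + 1 \<in> A)"

lemma good_choices_support_iff:
  "A \<in> good_choices (support n) n \<longleftrightarrow> A \<subseteq> support n \<and> covers A n"
  by (auto simp: good_choices_def support_def covers_def)

lemma covers_Suc: "covers A (Suc n) \<longleftrightarrow> covers A n \<and> (P (Suc n) \<or> n \<in> A \<or> Suc (Suc n) \<in> A)"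
  by (auto simp: covers_def atLeastAtMostSuc_conv)

lemma covers_cong:
  assumes "\<And>i. i \<le> Suc n \<Longrightarrow> i \<in> A \<longleftrightarrow> i \<in> B"
  shows "covers A n \<longleftrightarrow> covers B n"
  unfolding covers_def by (intro ball_cong refl) (use assms in auto)

lemma finite_good_choices_support: "finite (good_choices (support n) n)"
  by (rule finite_subset[of _ "Pow (support n)"]) (auto simp: good_choices_def support_def)

lemma support_Suc: "support (Suc n) = (if P (Suc n) then insert (Suc n) (support n) else support n)"
  by (auto simp: support_def le_Suc_eq)

text \<open>The new last vertex has no leaf and no right neighbour, so its only possible dominator
  is the path vertex with index \<open>n\<close>.\<close>

lemma good_choices_Suc_not:
  assumes "\<not> P (Suc n)"
  shows "good_choices (support (Suc n)) (Suc n) = {A \<in> good_choices (support n) n. n \<in> A}"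
proof (intro set_eqI)
  fix A
  have "A \<subseteq> support n \<Longrightarrow> Suc (Suc n) \<notin> A"
    by (auto simp: support_def)
  then show "A \<in> good_choices (support (Suc n)) (Suc n) \<longleftrightarrow>
      A \<in> {A \<in> good_choices (support n) n. n \<in> A}"
    using assms unfolding good_choices_support_iff mem_Collect_eq covers_Suc
    by (auto simp: support_Suc)
qed

text \<open>Split on whether the last support \<open>n + 2\<close> is chosen. If so, it covers the
  unsupported \<open>n + 1\<close>, and the rest is any good choice for \<open>n\<close>. If not,
  \<open>n + 1\<close> must be covered by \<open>n\<close>, which is a good choice for
  \<open>n + 1\<close>.\<close>

lemma good_choices_Suc_Suc:
  assumes "P n"
  shows "good_choices (support (Suc (Suc n))) (Suc (Suc n)) =
    insert (Suc (Suc n)) ` good_choices (support n) n \<union> good_choices (support (Suc n)) (Suc n)"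
    (is "?T2 = insert ?m ` ?T0 \<union> ?T1")
proof -
  have P: "\<not> P (Suc n)" "P ?m"
    using assms by (simp_all add: alternate)
  have T2: "A \<in> ?T2 \<longleftrightarrow> A \<subseteq> insert ?m (support n) \<and> covers A n \<and> (n \<in> A \<or> ?m \<in> A)" for A
    unfolding good_choices_support_iff using P by (simp add: support_Suc covers_Suc)
  have T1: "A \<in> ?T1 \<longleftrightarrow> A \<subseteq> support n \<and> covers A n \<and> n \<in> A" for A
    by (auto simp: good_choices_Suc_not[OF P(1)] good_choices_support_iff)
  show ?thesis
  proof (intro set_eqI iffI)
    fix A assume A: "A \<in> ?T2"
    show "A \<in> insert ?m ` ?T0 \<union> ?T1"
    proof (cases "?m \<in> A")
      case True
      have "A \<subseteq> insert ?m (support n)" and "covers A n"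
        using A unfolding T2 by simp_all
      \<comment> \<open>Covering up to \<open>n\<close> inspects indices up to \<open>n + 1\<close>
        only, so removing \<open>n + 2\<close> changes nothing.\<close>
      moreover have "covers (A - {?m}) n \<longleftrightarrow> covers A n"
        by (rule covers_cong) auto
      ultimately have "A - {?m} \<in> ?T0"
        by (simp add: good_choices_support_iff subset_insert_iff Diff_subset_conv)
      moreover have "A = insert ?m (A - {?m})"
        using True by blast
      ultimately show ?thesis
        by (metis UnI1 image_eqI)
    next
      case False
      then have "A \<in> ?T1"
        using A unfolding T1 T2 by blast
      then show ?thesis by (rule UnI2)
    qed
  next
    fix A assume "A \<in> insert ?m ` ?T0 \<union> ?T1"
    then show "A \<in> ?T2"
    proof
      assume "A \<in> insert ?m ` ?T0"
      then obtain B where B: "A = insert ?m B" "B \<in> ?T0"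
        by blast
      have "B \<subseteq> support n" and "covers B n"
        using B(2) by (simp_all add: good_choices_support_iff)
      moreover have "covers A n \<longleftrightarrow> covers B n"
        by (rule covers_cong) (simp add: B(1))
      ultimately show ?thesis
        unfolding T2 B(1) by auto
    next
      assume "A \<in> ?T1"
      then show ?thesis
        unfolding T1 T2 by blast
    qed
  qed
qed

text \<open>The first recurrence counts the two disjoint families of the split. For the second, the
  unsupported \<open>n + 3\<close> forces \<open>n + 2\<close> to be chosen, which keeps just the
  first family. The pair \<open>(count n, count (Suc n))\<close> thus moves like
  \<open>(a, b)\<close> to \<open>(a + b, a)\<close>, a Fibonacci step.\<close>

lemma count_Suc_Suc:
  assumes "P n"
  shows "count (Suc (Suc n)) = count n + count (Suc n)"
    and "count (Suc (Suc (Suc n))) = count n"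
proof -
  let ?m = "Suc (Suc n)"
  have fresh: "?m \<notin> A" if "A \<in> good_choices (support n) n \<union> good_choices (support (Suc n)) (Suc n)" for A
    using that by (auto simp: good_choices_def support_def)
  have card: "card (insert ?m ` good_choices (support n) n) = count n"
    unfolding count_def
    by (intro card_image inj_onI) (metis UnI1 fresh insert_ident)
  show "count ?m = count n + count (Suc n)"
    unfolding count_def[of ?m] good_choices_Suc_Suc[OF assms]
    using fresh by (subst card_Un_disjoint)
      (auto simp: card finite_good_choices_support count_def)
  have "{A \<in> good_choices (support ?m) ?m. ?m \<in> A} = insert ?m ` good_choices (support n) n"
    unfolding good_choices_Suc_Suc[OF assms] using fresh by auto
  then show "count (Suc ?m) = count n"
    unfolding count_def[of "Suc ?m"]
    using assms by (subst good_choices_Suc_not) (simp_all add: alternate card)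
qed

text \<open>The offset \<open>j\<close> records where in the Fibonacci sequence the initial pair
  sits; this is all that distinguishes the two parities.\<close>

lemma count_add_twice:
  assumes "P m" and "count m = fib (j + 1)" and "count (Suc m) = fib j"
  shows "count (m + 2 * k) = fib (j + k + 1) \<and> count (Suc (m + 2 * k)) = fib (j + k)"
proof -
  have "P (m + 2 * k) \<and> count (m + 2 * k) = fib (j + k + 1) \<and> count (Suc (m + 2 * k)) = fib (j + k)"
    by (induction k) (use assms in \<open>simp_all add: alternate count_Suc_Suc\<close>)
  then show ?thesis by blast
qed

lemma support_good:
  assumes "n \<ge> 2"
  shows "support n \<in> good_choices (support n) n"
proof -
  have "i - 1 \<in> support n \<or> i + 1 \<in> support n" if "1 \<le> i" "i \<le> n" "\<not> P i" for i
  \<comment> \<open>An unsupported index has a support just before it, except at the left end; there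
    the neighbour 2 serves, and it exists since \<open>n \<ge> 2\<close>.\<close>
  proof (cases "i = 1")
    case True
    then show ?thesis using that assms by (auto simp: support_def alternate)
  next
    case False
    then obtain j where "i = Suc j" "1 \<le> j"
      using \<open>1 \<le> i\<close> by (cases i) auto
    then show ?thesis using that by (auto simp: support_def alternate)
  qed
  then show ?thesis by (auto simp: good_choices_support_iff covers_def)
qed

lemma domination_support:
  assumes "n \<ge> 2"
  shows "domination_number (attach_leaves {i \<in> {1..n}. P i} (path_graph n)) = card (support n)"
    and "dominion (attach_leaves {i \<in> {1..n}. P i} (path_graph n)) = count n"
proof -
  have "support n \<subseteq> {1..n}"
    by (auto simp: support_def)
  from domination_attach_leaves[OF this support_good[OF assms]]
  show "domination_number (attach_leaves {i \<in> {1..n}. P i} (path_graph n)) = card (support n)"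
    and "dominion (attach_leaves {i \<in> {1..n}. P i} (path_graph n)) = count n"
    by (simp_all only: support_def[symmetric] count_def)
qed

end

section \<open>Fibonacci values for even and odd supports\<close>

interpretation evens: alternating even
  by unfold_locales simp

interpretation odds: alternating odd
  by unfold_locales simp

lemma card_support_evens: "card (evens.support n) = n div 2"
  by (induction n) (auto simp: evens.support_Suc, auto simp: evens.support_def)

lemma card_support_odds: "card (odds.support n) = (n + 1) div 2"
  by (induction n) (auto simp: odds.support_Suc, auto simp: odds.support_def)

lemma good_choices_evens_0: "good_choices (evens.support 0) 0 = {{}}"
  by (auto simp: good_choices_def evens.support_def)

lemma count_evens: "evens.count (2 * k) = fib (k + 1)" "evens.count (2 * k + 1) = fib k"
proof -
  \<comment> \<open>The empty path has one good choice, a single unsupported vertex has none. The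
    value at 1 only seeds the recurrence: it is not the dominion, since a lone vertex must dominate
    itself.\<close>
  have "evens.count 0 = fib (0 + 1)" "evens.count (Suc 0) = fib 0"
    by (simp_all add: evens.count_def evens.good_choices_Suc_not good_choices_evens_0)
  from evens.count_add_twice[OF _ this, of k]
  show "evens.count (2 * k) = fib (k + 1)" "evens.count (2 * k + 1) = fib k"
    by simp_all
qed

lemma good_choices_odds_1: "good_choices (odds.support (Suc 0)) (Suc 0) = {{}, {Suc 0}}"
proof -
  have "odds.support (Suc 0) = {Suc 0}"
    by (auto simp: odds.support_def)
  then show ?thesis
    by (auto simp: good_choices_def)
qed

lemma count_odds: "odds.count (2 * k + 1) = fib (k + 3)" "odds.count (2 * k + 2) = fib (k + 2)"
proof -
  have fib: "fib 2 = 1" "fib 3 = 2"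
    by (simp_all add: numeral_eq_Suc)
  \<comment> \<open>The induction starts at 1, the first index with a support. Both subsets of
    \<open>{1}\<close> are good there, and only \<open>{1}\<close> remains once vertex 2 must be
    covered; the pair \<open>(2, 1)\<close> gives offset 2.\<close>
  have "odds.count 1 = fib (2 + 1)" "odds.count (Suc 1) = fib 2"
  proof -
    have "{A. (A = {} \<or> A = {Suc 0}) \<and> Suc 0 \<in> A} = {{Suc 0}}"
      by auto
    then show "odds.count (Suc 1) = fib 2"
      by (simp add: odds.count_def odds.good_choices_Suc_not good_choices_odds_1 fib)
  qed (simp add: odds.count_def good_choices_odds_1 fib)
  from odds.count_add_twice[OF _ this, of k]
  show "odds.count (2 * k + 1) = fib (k + 3)" "odds.count (2 * k + 2) = fib (k + 2)"
    by (simp_all add: numeral_3_eq_3)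
qed

theorem theorem8:
  fixes n k :: nat
  assumes "n \<ge> 2"
    and "k = nat \<lfloor>real n / 2\<rfloor>"
  shows "domination_number (E_graph n) = k
    \<and> (n = 2 * k \<longrightarrow> dominion (E_graph n) = fib (k + 1))
    \<and> (n = 2 * k + 1 \<longrightarrow> dominion (E_graph n) = fib k)
    \<and> domination_number (O_graph n) = nat \<lceil>real n / 2\<rceil>
    \<and> (n = 2 * k \<longrightarrow> dominion (O_graph n) = fib (k + 1))
    \<and> (n = 2 * k + 1 \<longrightarrow> dominion (O_graph n) = fib (k + 3))"
proof -
  have k: "k = n div 2"
    using assms(2) by linarith
  have ceil: "nat \<lceil>real n / 2\<rceil> = (n + 1) div 2"
    by linarith
  have "odds.count n = fib (k + 1)" if n: "n = 2 * k"
  proof -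
    \<comment> \<open>\<open>count_odds(2)\<close> speaks of \<open>2 * j + 2\<close>, so
      \<open>k\<close> is shifted by one; \<open>n \<ge> 2\<close> rules out
      \<open>k = 0\<close>.\<close>
    obtain j where "k = Suc j"
      using n \<open>n \<ge> 2\<close> by (cases k) auto
    then show ?thesis
      using count_odds(2)[of j] n by simp
  qed
  then show ?thesis
    unfolding E_graph_def O_graph_def ceil
      evens.domination_support[OF \<open>n \<ge> 2\<close>] odds.domination_support[OF \<open>n \<ge> 2\<close>]
    using k card_support_evens card_support_odds count_evens[of k] count_odds(1)[of k] by auto
qed

end
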